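(* Let $k$ be a field of characteristic zero. Then $(1,3,6,10,15,21,28,27,27,28)$ is a level $h$-vector; that is, there exists a level algebra $A=k[x_1,x_2,x_3]/I$ whose $h$-vector is $(1,3,6,10,15,21,28,27,27,28)$.
   Context: A standard graded artinian algebra is $A=R/I$, where $R=k[x_1,\dots,x_r]$ with all $x_i$ of degree 1 and $I$ is a homogeneous ideal of $R$ containing no non-zero forms of degree at most 1, such that $\dim_k A<\infty$. The $h$-vector of $A$ is $(h_0,h_1,\dots,h_e)$, where $h_i=\dim_k A_i$ and $e$ is the last index with $\dim_k A_e>0$; $e$ is the socle degree of $A$. The codimension of $A$ is $r=h_1$. The socle of $A$ is $\mathrm{soc}(A)=\{a\in A : a\,\overline{m}=0\}$, where $\overline{m}=(\overline{x_1},\dots,\overline{x_r})\subseteq A$; it is a homogeneous ideal. $A$ is level if its socle is concentrated in degree $e$, i.e. $\mathrm{soc}(A)_i=0$ for all $i<e$ (equivalently $\mathrm{soc}(A)=A_e$). A level $h$-vector is the $h$-vector of some level algebra. *)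

theory Defs
  imports
    "HOL-Algebra.Algebraic_Closure_Type"
    "HOL-Algebra.QuotRing"
    "HOL-Algebra.Embedded_Algebras"
    "HOL-Library.Poly_Mapping"
    "HOL-Library.Numeral_Type"
begin

text \<open>
  The polynomial ring over \<^typ>\<open>'k\<close> with one variable for each element of a finite type
  \<^typ>\<open>'n\<close> is the monoid algebra of the additive monoid of exponent vectors
  \<open>'n \<Rightarrow>\<^sub>0 nat\<close>, so that \<open>k[x\<^sub>1, x\<^sub>2, x\<^sub>3]\<close> is the type \<open>(3, 'k) mpoly\<close>.
\<close>

type_synonym ('n, 'k) mpoly = "('n \<Rightarrow>\<^sub>0 nat) \<Rightarrow>\<^sub>0 'k"

definition mpoly_ring :: "('n::finite, 'k::field) mpoly ring" where
  "mpoly_ring = ring_of_type_algebra"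

definition mvar :: "'n::finite \<Rightarrow> ('n, 'k::field) mpoly" where
  "mvar j = Poly_Mapping.single (Poly_Mapping.single j 1) 1"

definition mconst :: "'k::field \<Rightarrow> ('n::finite, 'k) mpoly" where
  "mconst c = Poly_Mapping.single 0 c"

definition monom_degree :: "('n::finite \<Rightarrow>\<^sub>0 nat) \<Rightarrow> nat" where
  "monom_degree m = (\<Sum>j\<in>UNIV. Poly_Mapping.lookup m j)"

text \<open>The forms of degree \<open>d\<close>, including zero.\<close>

definition forms :: "nat \<Rightarrow> ('n::finite, 'k::field) mpoly set" where
  "forms d = {f. \<forall>m\<in>Poly_Mapping.keys f. monom_degree m = d}"

definition homogeneous_ideal :: "('n::finite, 'k::field) mpoly set \<Rightarrow> bool" where
  "homogeneous_ideal I \<longleftrightarrow> (\<exists>S. S \<subseteq> (\<Union>d. forms d) \<and> I = Idl\<^bsub>mpoly_ring\<^esub> S)"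

definition quot_alg :: "('n::finite, 'k::field) mpoly set \<Rightarrow> ('n, 'k) mpoly set ring" where
  "quot_alg I = mpoly_ring Quot I"

definition res_class ::
    "('n::finite, 'k::field) mpoly set \<Rightarrow> ('n, 'k) mpoly \<Rightarrow> ('n, 'k) mpoly set" where
  "res_class I f = I +>\<^bsub>mpoly_ring\<^esub> f"

text \<open>The image of \<open>k\<close> in \<open>A = R/I\<close>; it serves as the field of scalars for \<^const>\<open>ring.dim\<close>.\<close>

definition scalars :: "('n::finite, 'k::field) mpoly set \<Rightarrow> ('n, 'k) mpoly set set" where
  "scalars I = range (\<lambda>c. res_class I (mconst c))"

definition graded_piece ::
    "('n::finite, 'k::field) mpoly set \<Rightarrow> nat \<Rightarrow> ('n, 'k) mpoly set set" where
  "graded_piece I i = res_class I ` forms i"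

definition standard_graded_artinian :: "('n::finite, 'k::field) mpoly set \<Rightarrow> bool" where
  "standard_graded_artinian I \<longleftrightarrow>
     homogeneous_ideal I \<and>
     (\<forall>d\<le>1. \<forall>f\<in>I \<inter> forms d. f = 0) \<and>
     ring.finite_dimension (quot_alg I) (scalars I) (carrier (quot_alg I))"

definition hilbert_function :: "('n::finite, 'k::field) mpoly set \<Rightarrow> nat \<Rightarrow> nat" where
  "hilbert_function I i = ring.dim (quot_alg I) (scalars I) (graded_piece I i)"

definition socle_degree :: "('n::finite, 'k::field) mpoly set \<Rightarrow> nat" where
  "socle_degree I = (GREATEST i. hilbert_function I i > 0)"

definition h_vector :: "('n::finite, 'k::field) mpoly set \<Rightarrow> nat list" where
  "h_vector I = map (hilbert_function I) [0..<Suc (socle_degree I)]"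

definition irrelevant_ideal :: "('n::finite, 'k::field) mpoly set \<Rightarrow> ('n, 'k) mpoly set set" where
  "irrelevant_ideal I = Idl\<^bsub>quot_alg I\<^esub> (range (\<lambda>j. res_class I (mvar j)))"

definition socle :: "('n::finite, 'k::field) mpoly set \<Rightarrow> ('n, 'k) mpoly set set" where
  "socle I = {a \<in> carrier (quot_alg I).
     \<forall>b\<in>irrelevant_ideal I. a \<otimes>\<^bsub>quot_alg I\<^esub> b = \<zero>\<^bsub>quot_alg I\<^esub>}"

definition level_algebra :: "('n::finite, 'k::field) mpoly set \<Rightarrow> bool" where
  "level_algebra I \<longleftrightarrow>
     standard_graded_artinian I \<and>
     (\<forall>i<socle_degree I. socle I \<inter> graded_piece I i = {\<zero>\<^bsub>quot_alg I\<^esub>})"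

end

theory Submission
  imports Defs
begin

text \<open>
  The ideal is \<open>I = x\<^sup>3 Ann(G) + m\<^sup>10\<close>, where \<open>G\<close> is the sextic dual form
  \<open>X\<^sup>2Y\<^sup>2Z\<^sup>2 + X\<^sup>6 + Y\<^sup>6 + Z\<^sup>6\<close> on which polynomials act by contraction; equivalently, \<open>I\<close> is the
  annihilator of the degree 9 forms killed by \<open>x\<^sup>3\<close> together with one form \<open>F\<close> satisfying
  \<open>x\<^sup>3 F = G\<close>. The catalecticant of \<open>G\<close> on cubics is a permutation matrix, so \<open>R/Ann(G)\<close> has the
  \<open>h\<close>-vector \<open>(1,3,6,10,6,3,1)\<close>; adding the monomials not divisible by \<open>x\<^sup>3\<close>, whose numbers in
  degrees 0 to 9 are \<open>1,3,6,9,12,15,18,21,24,27\<close>, gives the claim. A socle element of degree below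
  9 is divisible by \<open>x\<^sup>3\<close>, because multiplication by \<open>y\<close> is injective modulo \<open>x\<^sup>3\<close>, and its quotient
  by \<open>x\<^sup>3\<close> is then a socle element of the Gorenstein algebra \<open>R/Ann(G)\<close> of degree below 6, hence
  zero. Since \<open>Ann(G)\<close> is generated by monomials and differences of monomials, all computations
  take place on exponent vectors.
\<close>

section \<open>Quotients by monomial and binomial relations\<close>

lemma mpoly_ring_simps [simp]:
  "carrier mpoly_ring = UNIV"
  "f \<otimes>\<^bsub>mpoly_ring\<^esub> g = f * g"
  "f \<oplus>\<^bsub>mpoly_ring\<^esub> g = f + g"
  "\<one>\<^bsub>mpoly_ring\<^esub> = 1"
  "\<zero>\<^bsub>mpoly_ring\<^esub> = 0"
  by (simp_all add: mpoly_ring_def ring_of_type_algebra_def)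

lemma cring_mpoly_ring: "cring mpoly_ring"
  unfolding mpoly_ring_def by (rule cring_from_type_algebra)

lemma a_inv_mpoly_ring [simp]: "\<ominus>\<^bsub>mpoly_ring\<^esub> f = - f"
proof -
  interpret cring mpoly_ring by (rule cring_mpoly_ring)
  show ?thesis
    by (rule minus_equality) auto
qed

lemma a_minus_mpoly_ring [simp]: "f \<ominus>\<^bsub>mpoly_ring\<^esub> g = f - g"
  by (simp add: a_minus_def)

lemma poly_mapping_sum_single:
  fixes f :: "'a \<Rightarrow>\<^sub>0 'b::comm_monoid_add"
  shows "(\<Sum>m\<in>Poly_Mapping.keys f. Poly_Mapping.single m (Poly_Mapping.lookup f m)) = f"
  by (rule poly_mapping_eqI)
     (auto simp: lookup_sum lookup_single when_def in_keys_iff sum.delta)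

lemma poly_mapping_induct_add [case_names single add]:
  fixes f :: "'a \<Rightarrow>\<^sub>0 'b::comm_monoid_add"
  assumes single: "\<And>m c. P (Poly_Mapping.single m c)"
    and add: "\<And>f g. P f \<Longrightarrow> P g \<Longrightarrow> P (f + g)"
  shows "P f"
proof -
  have "P (\<Sum>m\<in>A. Poly_Mapping.single m (Poly_Mapping.lookup f m))" if "finite A" for A
    using that
  proof induction
    case empty
    \<comment> \<open>The empty sum counts as a term with coefficient 0, on an arbitrary
      monomial.\<close>
    show ?case using single[of undefined 0] by simp
  qed (auto intro: single add)
  from this[of "Poly_Mapping.keys f"] show ?thesis
    by (simp add: poly_mapping_sum_single)
qed

lemma sum_mem:
  assumes "0 \<in> U" "\<And>x y. x \<in> U \<Longrightarrow> y \<in> U \<Longrightarrow> x + y \<in> U" "\<And>a. a \<in> A \<Longrightarrow> t a \<in> U"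
  shows "sum t A \<in> U"
  using assms(3) by (induction A rule: infinite_finite_induct) (auto simp: assms)

lemma monom_degree_zero [simp]: "monom_degree 0 = 0"
  by (simp add: monom_degree_def)

lemma monom_degree_add [simp]: "monom_degree (m + n) = monom_degree m + monom_degree n"
  by (simp add: monom_degree_def lookup_add sum.distrib)

lemma monom_degree_single [simp]: "monom_degree (Poly_Mapping.single j k) = k"
  by (simp add: monom_degree_def lookup_single when_def)

lemma monom_degree_eq_0_iff [simp]: "monom_degree m = 0 \<longleftrightarrow> m = 0"
  by (auto simp: monom_degree_def intro!: poly_mapping_eqI)

lemma exponent_induct [case_names zero add]:
  fixes s :: "'n::finite \<Rightarrow>\<^sub>0 nat"
  assumes zero: "P 0" and add: "\<And>s j. P s \<Longrightarrow> P (s + Poly_Mapping.single j 1)"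
  shows "P s"
proof (induction "monom_degree s" arbitrary: s)
  case 0
  then show ?case using zero by simp
next
  case (Suc d)
  then have "s \<noteq> 0" by auto
  then obtain j where j: "Poly_Mapping.lookup s j \<noteq> 0"
    by (metis lookup_zero poly_mapping_eqI)
  define t where "t = s - Poly_Mapping.single j 1"
  have s: "s = t + Poly_Mapping.single j 1"
    using j by (intro poly_mapping_eqI)
      (auto simp: t_def lookup_add lookup_minus lookup_single when_def)
  have "d = monom_degree t" using Suc(2) by (simp add: s)
  then show ?case using Suc(1) add by (simp add: s)
qed

text \<open>
  \<open>nf m = None\<close> encodes the relation \<open>m = 0\<close> and \<open>nf m = Some b\<close> the relation \<open>m = b\<close>; the
  monomials fixed by \<open>nf\<close> are then a basis of the quotient.
\<close>

locale monomial_reduction =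
  fixes nf :: "('n::finite \<Rightarrow>\<^sub>0 nat) \<Rightarrow> ('n \<Rightarrow>\<^sub>0 nat) option"
  assumes nf_idem: "nf m = Some b \<Longrightarrow> nf b = Some b"
    and nf_degree: "nf m = Some b \<Longrightarrow> monom_degree b = monom_degree m"
    and nf_add_var: "nf (m + Poly_Mapping.single j 1) =
      Option.bind (nf m) (\<lambda>b. nf (b + Poly_Mapping.single j 1))"
    and nf_low: "monom_degree m \<le> 1 \<Longrightarrow> nf m = Some m"
    and finite_fixed: "finite {m. nf m = Some m}"
begin

text \<open>Compatibility with one variable extends to every monomial \<open>s\<close> by adding its
  variables one at a time. Hence a factor may be reduced before multiplying.\<close>

lemma nf_add: "nf (m + s) = Option.bind (nf m) (\<lambda>b. nf (b + s))"
proof (induction s rule: exponent_induct)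
  case zero
  show ?case by (cases "nf m") (auto simp: nf_idem)
next
  case (add s j)
  have "nf (m + s + Poly_Mapping.single j 1) =
      Option.bind (nf m) (\<lambda>b. Option.bind (nf (b + s)) (\<lambda>b. nf (b + Poly_Mapping.single j 1)))"
    unfolding nf_add_var[of "m + s"] add by (cases "nf m") auto
  then show ?case
    by (simp only: nf_add_var[of "_ + s", symmetric] add.assoc)
qed

section \<open>The reduction map and its kernel\<close>

definition red_term :: "('n \<Rightarrow>\<^sub>0 nat) \<Rightarrow> 'k::field \<Rightarrow> ('n, 'k) mpoly" where
  "red_term m c = (case nf m of None \<Rightarrow> 0 | Some b \<Rightarrow> Poly_Mapping.single b c)"

text \<open>The linear extension of \<open>nf\<close>: a projection of the polynomial ring onto the
  span of the fixed monomials.\<close>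

definition red :: "('n, 'k::field) mpoly \<Rightarrow> ('n, 'k) mpoly" where
  "red f = (\<Sum>m\<in>Poly_Mapping.keys f. red_term m (Poly_Mapping.lookup f m))"

text \<open>Defining the ideal as the kernel of a projection, rather than by generators, turns
  equality in the quotient into equality of reduced polynomials.\<close>

definition red_ideal :: "('n, 'k::field) mpoly set" where
  "red_ideal = {f. red f = 0}"

lemma red_term_zero [simp]: "red_term m 0 = 0"
  by (simp add: red_term_def split: option.split)

lemma red_add: "red (f + g) = red f + red g"
  unfolding red_def
  by (rule setsum_keys_plus_distrib) (auto simp: red_term_def single_add split: option.split)

lemma red_single [simp]: "red (Poly_Mapping.single m c) = red_term m c"
  by (simp add: red_def)

lemma red_zero [simp]: "red 0 = 0"
  by (simp add: red_def)

lemma red_uminus: "red (- f) = - red f"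
  using red_add[of f "- f"] by (simp add: eq_neg_iff_add_eq_0 add.commute)

lemma red_diff: "red (f - g) = red f - red g"
  using red_add[of f "- g"] by (simp add: red_uminus)

text \<open>Both sides are additive in \<open>f\<close> and in \<open>g\<close>, so only single
  terms matter, and there the claim is \<open>nf_add\<close>. This is what makes the kernel of
  \<open>red\<close> an ideal.\<close>

lemma red_mult: "red (red f * g) = red (f * g)"
proof (induction g rule: poly_mapping_induct_add)
  case (single s d)
  show ?case
  proof (induction f rule: poly_mapping_induct_add)
    case (single m c)
    show ?case
      by (cases "nf m") (simp_all add: red_term_def mult_single nf_add[of m s])
  qed (simp add: red_add distrib_right)
qed (simp add: red_add distrib_left)

lemma red_red [simp]: "red (red f) = red f"
  using red_mult[of f 1] by simp

lemma keys_red_term: "Poly_Mapping.keys (red_term m c) \<subseteq> set_option (nf m)"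
  by (auto simp: red_term_def split: option.splits)

lemma keys_red:
  fixes f :: "('n, 'k::field) mpoly"
  shows "Poly_Mapping.keys (red f) \<subseteq> (\<Union>m\<in>Poly_Mapping.keys f. set_option (nf m))"
proof -
  define U where "U = {g :: ('n, 'k) mpoly.
    Poly_Mapping.keys g \<subseteq> (\<Union>m\<in>Poly_Mapping.keys f. set_option (nf m))}"
  have "red f \<in> U"
    unfolding red_def
  proof (rule sum_mem)
    show "g + h \<in> U" if "g \<in> U" "h \<in> U" for g h
      using that Poly_Mapping.keys_add[of g h] unfolding U_def by blast
  next
    show "red_term m (Poly_Mapping.lookup f m) \<in> U" if "m \<in> Poly_Mapping.keys f" for m
      using that keys_red_term[of m "Poly_Mapping.lookup f m"] unfolding U_def by blast
  qed (simp add: U_def)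
  then show ?thesis by (simp add: U_def)
qed

lemma red_fixed:
  assumes "\<And>m. m \<in> Poly_Mapping.keys f \<Longrightarrow> nf m = Some m"
  shows "red f = f"
proof -
  have "red f = (\<Sum>m\<in>Poly_Mapping.keys f. Poly_Mapping.single m (Poly_Mapping.lookup f m))"
    unfolding red_def by (rule sum.cong) (auto simp: red_term_def assms)
  then show ?thesis by (simp add: poly_mapping_sum_single)
qed

lemma ideal_red_ideal: "ideal (red_ideal :: ('n, 'k::field) mpoly set) mpoly_ring"
proof -
  interpret R: cring "mpoly_ring :: ('n, 'k) mpoly ring" by (rule cring_mpoly_ring)
  have mult: "red (f * g) = 0" if "red f = 0" for f g :: "('n, 'k) mpoly"
    using red_mult[of f g] that by simp
  show ?thesis
  proof (rule idealI[OF R.ring_axioms])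
    show "subgroup red_ideal (add_monoid (mpoly_ring :: ('n, 'k) mpoly ring))"
      by (rule R.add.subgroupI)
         (auto simp: red_ideal_def red_add red_uminus a_inv_def[symmetric] intro!: exI[of _ 0])
  qed (auto simp: red_ideal_def mult, metis mult mult.commute)
qed

text \<open>A term minus its reduction is homogeneous because \<open>nf\<close> preserves degrees,
  and lies in the kernel because \<open>red\<close> is idempotent; each element of the kernel is the
  sum of these differences over its terms.\<close>

lemma homogeneous_red_ideal: "homogeneous_ideal (red_ideal :: ('n, 'k::field) mpoly set)"
proof -
  interpret R: cring "mpoly_ring :: ('n, 'k) mpoly ring" by (rule cring_mpoly_ring)
  define S :: "('n, 'k) mpoly set" where "S = red_ideal \<inter> (\<Union>d. forms d)"
  interpret J: ideal "Idl\<^bsub>mpoly_ring\<^esub> S" mpoly_ring by (rule R.genideal_ideal) simp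
  have S: "S \<subseteq> Idl\<^bsub>mpoly_ring\<^esub> S" by (rule R.genideal_self) simp
  have "red_ideal \<subseteq> Idl\<^bsub>mpoly_ring\<^esub> S"
  proof
    fix f :: "('n, 'k) mpoly" assume "f \<in> red_ideal"
    define t where "t m = Poly_Mapping.single m (Poly_Mapping.lookup f m)
      - red_term m (Poly_Mapping.lookup f m)" for m
    have "f = (\<Sum>m\<in>Poly_Mapping.keys f. t m)"
      using \<open>f \<in> red_ideal\<close>
      by (simp add: t_def sum_subtractf poly_mapping_sum_single red_ideal_def red_def[symmetric])
    moreover have "t m \<in> Idl\<^bsub>mpoly_ring\<^esub> S" for m
    proof (rule set_mp[OF S])
      have "red (t m) = 0"
        by (simp add: t_def red_diff flip: red_single)
      moreover have "t m \<in> forms (monom_degree m)"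
        using keys_red_term[of m "Poly_Mapping.lookup f m"]
        by (auto simp: forms_def t_def dest!: set_mp[OF keys_diff] nf_degree split: if_splits)
      ultimately show "t m \<in> S" by (auto simp: S_def red_ideal_def)
    qed
    then have "(\<Sum>m\<in>Poly_Mapping.keys f. t m) \<in> Idl\<^bsub>mpoly_ring\<^esub> S"
      using J.zero_closed J.a_closed
      by (intro sum_mem) auto
    ultimately show "f \<in> Idl\<^bsub>mpoly_ring\<^esub> S" by simp
  qed
  moreover have "Idl\<^bsub>mpoly_ring\<^esub> S \<subseteq> red_ideal"
    by (rule R.genideal_minimal[OF ideal_red_ideal]) (auto simp: S_def)
  ultimately show ?thesis
    unfolding homogeneous_ideal_def by (intro exI[of _ S]) (auto simp: S_def)
qed

section \<open>The quotient algebra and its field of scalars\<close>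

lemma res_class_eq_iff:
  "res_class red_ideal f = res_class red_ideal g \<longleftrightarrow> red f = red g"
  using ring.quotient_eq_iff_same_a_r_cos[OF cring.axioms(1)[OF cring_mpoly_ring]
      ideal_red_ideal, of f g]
  by (auto simp: res_class_def red_ideal_def red_diff)

lemma res_class_red [simp]: "res_class red_ideal (red f) = res_class red_ideal f"
  by (simp add: res_class_eq_iff)

lemma ring_hom_res_class:
  "ring_hom_ring mpoly_ring (quot_alg red_ideal) (res_class red_ideal)"
  using ideal.rcos_ring_hom_ring[OF ideal_red_ideal]
  by (simp add: quot_alg_def res_class_def[abs_def])

lemma quot_alg_simps:
  fixes f g :: "('n, 'k::field) mpoly"
  defines "Q \<equiv> quot_alg (red_ideal :: ('n, 'k) mpoly set)"
  shows "carrier Q = range (res_class red_ideal)"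
    and "res_class red_ideal f \<otimes>\<^bsub>Q\<^esub> res_class red_ideal g = res_class red_ideal (f * g)"
    and "res_class red_ideal f \<oplus>\<^bsub>Q\<^esub> res_class red_ideal g = res_class red_ideal (f + g)"
    and "\<one>\<^bsub>Q\<^esub> = res_class red_ideal 1"
    and "\<zero>\<^bsub>Q\<^esub> = res_class red_ideal 0"
proof -
  interpret h: ring_hom_ring "mpoly_ring :: ('n, 'k) mpoly ring" Q "res_class red_ideal"
    unfolding Q_def by (rule ring_hom_res_class)
  show "carrier Q = range (res_class red_ideal)"
    by (auto simp: Q_def quot_alg_def FactRing_def A_RCOSETS_def' res_class_def)
  show "res_class red_ideal f \<otimes>\<^bsub>Q\<^esub> res_class red_ideal g = res_class red_ideal (f * g)"
    using h.hom_mult[of f g] by simp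
  show "res_class red_ideal f \<oplus>\<^bsub>Q\<^esub> res_class red_ideal g = res_class red_ideal (f + g)"
    using h.hom_add[of f g] by simp
  show "\<one>\<^bsub>Q\<^esub> = res_class red_ideal 1"
    using h.hom_one by simp
  show "\<zero>\<^bsub>Q\<^esub> = res_class red_ideal 0"
    using h.hom_zero by simp
qed

lemma cring_quot_alg: "cring (quot_alg red_ideal)"
  unfolding quot_alg_def by (rule ideal.quotient_is_cring[OF ideal_red_ideal cring_mpoly_ring])

text \<open>A ring homomorphism from a field into a nonzero ring has a subfield as image; the
  quotient is nonzero because \<open>nf_low\<close> fixes the monomial 1.\<close>

lemma subfield_scalars:
  "subfield (scalars red_ideal) (quot_alg (red_ideal :: ('n, 'k::field) mpoly set))"
proof -
  let ?K = "ring_of_type_algebra :: 'k ring"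
  interpret K: field ?K by (rule field_from_type_algebra)
  interpret Q: cring "quot_alg (red_ideal :: ('n, 'k) mpoly set)" by (rule cring_quot_alg)
  have "(\<lambda>c. res_class red_ideal (mconst c))
      \<in> ring_hom ?K (quot_alg (red_ideal :: ('n, 'k) mpoly set))"
    by (rule ring_hom_memI)
       (auto simp: ring_of_type_algebra_def quot_alg_simps mconst_def mult_single single_add)
  then interpret h: ring_hom_ring ?K "quot_alg (red_ideal :: ('n, 'k) mpoly set)"
      "\<lambda>c. res_class red_ideal (mconst c)"
    by (intro ring_hom_ringI2) (auto intro: K.ring_axioms Q.ring_axioms)
  have "red (1 :: ('n, 'k) mpoly) = 1"
    by (rule red_fixed) (auto intro: nf_low)
  then have "\<one>\<^bsub>quot_alg (red_ideal :: ('n, 'k) mpoly set)\<^esub> \<noteq> \<zero>\<^bsub>quot_alg red_ideal\<^esub>"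
    by (simp add: quot_alg_simps res_class_eq_iff)
  then have "subfield ((\<lambda>c. res_class red_ideal (mconst c)) ` carrier ?K)
      (quot_alg (red_ideal :: ('n, 'k) mpoly set))"
    by (rule h.img_is_subfield(2)[OF K.carrier_is_subfield])
  then show ?thesis
    by (simp add: scalars_def ring_of_type_algebra_def)
qed

section \<open>Bases of fixed monomials and the Hilbert function\<close>

lemma Span_monomials:
  "ring.Span (quot_alg red_ideal) (scalars red_ideal)
     (map (\<lambda>m. res_class red_ideal (Poly_Mapping.single m (1 :: 'k::field))) ms) =
   res_class red_ideal ` {f. Poly_Mapping.keys f \<subseteq> set ms}"
proof (induction ms)
  case Nil
  interpret Q: cring "quot_alg (red_ideal :: ('n, 'k) mpoly set)" by (rule cring_quot_alg)
  show ?case by (auto simp: quot_alg_simps)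
next
  case (Cons m ms)
  interpret Q: cring "quot_alg (red_ideal :: ('n, 'k) mpoly set)" by (rule cring_quot_alg)
  let ?rc = "res_class (red_ideal :: ('n, 'k) mpoly set)"
  have "Q.line_extension (scalars red_ideal) (?rc (Poly_Mapping.single m 1))
      (?rc ` {f. Poly_Mapping.keys f \<subseteq> set ms}) =
    {?rc (Poly_Mapping.single m c + f) |c f. Poly_Mapping.keys f \<subseteq> set ms}"
    by (auto simp: Q.line_extension_mem_iff scalars_def quot_alg_simps mconst_def mult_single)
       blast+
  also have "\<dots> = ?rc ` {f. Poly_Mapping.keys f \<subseteq> set (m # ms)}"
  proof (intro equalityI subsetI)
    fix a assume "a \<in> {?rc (Poly_Mapping.single m c + f) |c f. Poly_Mapping.keys f \<subseteq> set ms}"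
    then obtain c f where a: "a = ?rc (Poly_Mapping.single m c + f)"
      and f: "Poly_Mapping.keys f \<subseteq> set ms" by blast
    have "Poly_Mapping.keys (Poly_Mapping.single m c + f) \<subseteq> set (m # ms)"
      using Poly_Mapping.keys_add[of "Poly_Mapping.single m c" f] f
      by (auto split: if_splits)
    with a show "a \<in> ?rc ` {f. Poly_Mapping.keys f \<subseteq> set (m # ms)}" by blast
  next
    fix a assume "a \<in> ?rc ` {f. Poly_Mapping.keys f \<subseteq> set (m # ms)}"
    then obtain f where a: "a = ?rc f" and f: "Poly_Mapping.keys f \<subseteq> set (m # ms)" by blast
    \<comment> \<open>Splitting off the term at \<open>m\<close> leaves a polynomial supported on
      the remaining monomials.\<close>
    define g where "g = f - Poly_Mapping.single m (Poly_Mapping.lookup f m)"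
    have "Poly_Mapping.keys g \<subseteq> set ms"
      using f by (auto simp: g_def in_keys_iff lookup_minus lookup_single when_def split: if_splits)
    moreover have "a = ?rc (Poly_Mapping.single m (Poly_Mapping.lookup f m) + g)"
      by (simp add: a g_def)
    ultimately show "a \<in> {?rc (Poly_Mapping.single m c + f) |c f.
        Poly_Mapping.keys f \<subseteq> set ms}"
      by blast
  qed
  finally show ?case using Cons by simp
qed

text \<open>On polynomials supported on fixed monomials \<open>red\<close> is the identity, so
  distinct ones have distinct classes; this gives linear independence.\<close>

lemma dimension_fixed_monomials:
  assumes "finite M" and "\<And>m. m \<in> M \<Longrightarrow> nf m = Some m"
  shows "ring.dimension (quot_alg red_ideal) (card M) (scalars red_ideal)
    (res_class red_ideal ` {f :: ('n, 'k::field) mpoly. Poly_Mapping.keys f \<subseteq> M})"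
proof -
  interpret Q: cring "quot_alg (red_ideal :: ('n, 'k) mpoly set)" by (rule cring_quot_alg)
  let ?us = "map (\<lambda>m. res_class red_ideal (Poly_Mapping.single m (1 :: 'k)))"
  have independent: "Q.independent (scalars red_ideal) (?us ms)"
    if "distinct ms" "set ms \<subseteq> M" for ms
    using that
  proof (induction ms)
    case (Cons m ms)
    have "res_class red_ideal (Poly_Mapping.single m (1 :: 'k)) \<noteq> res_class red_ideal f"
      if "Poly_Mapping.keys f \<subseteq> set ms" for f
    proof
      assume "res_class red_ideal (Poly_Mapping.single m (1 :: 'k)) = res_class red_ideal f"
      then have "red (Poly_Mapping.single m (1 :: 'k)) = red f" by (simp only: res_class_eq_iff)
      moreover have "red f = f" using that Cons.prems assms(2) by (intro red_fixed) auto
      moreover have "red (Poly_Mapping.single m (1 :: 'k)) = Poly_Mapping.single m 1"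
        using Cons.prems assms(2) by (intro red_fixed) auto
      ultimately have "Poly_Mapping.keys f = {m}" by (metis keys_single zero_neq_one)
      with that Cons.prems show False by auto
    qed
    then show ?case
      using Cons unfolding list.map
      by (intro Q.li_Cons) (auto simp: Span_monomials quot_alg_simps simp del: Q.Span.simps)
  qed simp
  obtain ms where ms: "set ms = M" "distinct ms"
    using finite_distinct_list[OF assms(1)] by blast
  have "Q.dimension (length (?us ms)) (scalars red_ideal)
      (Q.Span (scalars red_ideal) (?us ms))"
    using independent ms by (intro Q.dimension_independent) auto
  then show ?thesis
    using ms distinct_card[OF ms(2)] by (simp add: Span_monomials del: Q.Span.simps)
qed

text \<open>Replacing a form by its reduction changes neither its class nor its degree.\<close>

lemma graded_piece_red_ideal:
  "graded_piece (red_ideal :: ('n, 'k::field) mpoly set) d = res_class red_ideal `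
    {f. Poly_Mapping.keys f \<subseteq> {m. nf m = Some m \<and> monom_degree m = d}}"
proof -
  have "Poly_Mapping.keys (red f) \<subseteq> {m. nf m = Some m \<and> monom_degree m = d}"
    if "f \<in> forms d" for f :: "('n, 'k) mpoly"
    using keys_red[of f] that by (force simp: forms_def dest: nf_idem nf_degree)
  then show ?thesis
    unfolding graded_piece_def
    by (auto simp: forms_def image_iff) (metis (no_types, lifting) res_class_red)+
qed

lemma hilbert_function_red_ideal:
  "hilbert_function (red_ideal :: ('n, 'k::field) mpoly set) d =
    card {m. nf m = Some m \<and> monom_degree m = d}"
proof -
  interpret Q: cring "quot_alg (red_ideal :: ('n, 'k) mpoly set)" by (rule cring_quot_alg)
  have "finite {m. nf m = Some m \<and> monom_degree m = d}"
    by (rule finite_subset[OF _ finite_fixed]) auto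
  then have "Q.dimension (card {m. nf m = Some m \<and> monom_degree m = d}) (scalars red_ideal)
      (graded_piece red_ideal d)"
    unfolding graded_piece_red_ideal by (rule dimension_fixed_monomials) auto
  then show ?thesis
    using Q.dimI[OF subfield_scalars] by (simp add: hilbert_function_def over_def)
qed

text \<open>By \<open>nf_low\<close> a form of degree at most 1 equals its own reduction, so it lies
  in the kernel only if it is zero; finite dimension comes from \<open>finite_fixed\<close>.\<close>

lemma standard_graded_artinian_red_ideal:
  "standard_graded_artinian (red_ideal :: ('n, 'k::field) mpoly set)"
  unfolding standard_graded_artinian_def
proof (intro conjI allI impI ballI)
  show "homogeneous_ideal (red_ideal :: ('n, 'k) mpoly set)" by (rule homogeneous_red_ideal)
next
  fix d f assume "d \<le> (1 :: nat)" and f: "f \<in> (red_ideal :: ('n, 'k) mpoly set) \<inter> forms d"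
  then have "red f = f" by (intro red_fixed nf_low) (auto simp: forms_def)
  with f show "f = 0" by (simp add: red_ideal_def)
next
  interpret Q: cring "quot_alg (red_ideal :: ('n, 'k) mpoly set)" by (rule cring_quot_alg)
  have "Poly_Mapping.keys (red f) \<subseteq> {m. nf m = Some m}" for f :: "('n, 'k) mpoly"
    using keys_red[of f] by (force dest: nf_idem)
  then have "carrier (quot_alg (red_ideal :: ('n, 'k) mpoly set)) =
      res_class red_ideal ` {f. Poly_Mapping.keys f \<subseteq> {m. nf m = Some m}}"
    unfolding quot_alg_simps
    using res_class_red by blast
  moreover have "Q.dimension (card {m. nf m = Some m}) (scalars red_ideal)
      (res_class red_ideal ` {f. Poly_Mapping.keys f \<subseteq> {m. nf m = Some m}})"
    using finite_fixed by (rule dimension_fixed_monomials) auto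
  ultimately show "Q.finite_dimension (scalars red_ideal) (carrier (quot_alg red_ideal))"
    by (metis Q.finite_dimensionI)
qed

text \<open>
  The coefficients of a socle element vanish by induction on \<open>rank\<close>: multiplied by the variable \<open>j\<close>,
  the monomial \<open>b\<close> has the same normal form only as monomials of smaller rank.
\<close>

lemma socle_red_ideal:
  fixes rank :: "('n \<Rightarrow>\<^sub>0 nat) \<Rightarrow> nat"
  assumes separated: "\<And>b. nf b = Some b \<Longrightarrow> monom_degree b = d \<Longrightarrow>
    \<exists>j b'. nf (b + Poly_Mapping.single j 1) = Some b' \<and>
      (\<forall>c. nf c = Some c \<longrightarrow> nf (c + Poly_Mapping.single j 1) = Some b' \<longrightarrow> c \<noteq> b \<longrightarrow> rank c < rank b)"
  shows "socle red_ideal \<inter> graded_piece red_ideal d =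
    {\<zero>\<^bsub>quot_alg (red_ideal :: ('n, 'k::field) mpoly set)\<^esub>}"
proof (intro equalityI subsetI)
  interpret Q: cring "quot_alg (red_ideal :: ('n, 'k) mpoly set)" by (rule cring_quot_alg)
  fix a assume "a \<in> socle (red_ideal :: ('n, 'k) mpoly set) \<inter> graded_piece red_ideal d"
  then obtain f where a: "a = res_class red_ideal f" and "a \<in> socle red_ideal"
    and keys: "Poly_Mapping.keys f \<subseteq> {m. nf m = Some m \<and> monom_degree m = d}"
    unfolding graded_piece_red_ideal by blast
  have "res_class red_ideal (mvar j) \<in> irrelevant_ideal (red_ideal :: ('n, 'k) mpoly set)" for j
    unfolding irrelevant_ideal_def
    by (rule set_mp[OF Q.genideal_self]) (auto simp: quot_alg_simps)
  then have "a \<otimes>\<^bsub>quot_alg red_ideal\<^esub> res_class red_ideal (mvar j) = \<zero>\<^bsub>quot_alg red_ideal\<^esub>" for j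
    using \<open>a \<in> socle red_ideal\<close> unfolding socle_def by blast
  then have mvar: "red (f * mvar j) = 0" for j
    by (simp add: a quot_alg_simps res_class_eq_iff)
  have "red (\<Sum>m\<in>A. t m) = (\<Sum>m\<in>A. red (t m))" for A and t :: "('n \<Rightarrow>\<^sub>0 nat) \<Rightarrow> ('n, 'k) mpoly"
    by (induction A rule: infinite_finite_induct) (auto simp: red_add)
  then have red_mvar: "red (f * mvar j) = (\<Sum>m\<in>Poly_Mapping.keys f.
      red_term (m + Poly_Mapping.single j 1) (Poly_Mapping.lookup f m))" for j
    by (subst (1) poly_mapping_sum_single[of f, symmetric])
       (simp add: sum_distrib_right mvar_def mult_single)
  have "Poly_Mapping.lookup f b = 0" for b
  proof (induction "rank b" arbitrary: b rule: less_induct)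
    case less
    show ?case
    proof (rule ccontr)
      assume b: "Poly_Mapping.lookup f b \<noteq> 0"
      then obtain j b' where j: "nf (b + Poly_Mapping.single j 1) = Some b'"
        "\<And>c. nf c = Some c \<Longrightarrow> nf (c + Poly_Mapping.single j 1) = Some b' \<Longrightarrow> c \<noteq> b \<Longrightarrow> rank c < rank b"
        using separated keys by (auto simp: in_keys_iff subset_iff) metis
      \<comment> \<open>The coefficient of \<open>b'\<close> in \<open>red (f * mvar j)\<close>
        collects the coefficients in \<open>f\<close> of \<open>b\<close> and of monomials of
        smaller rank; the latter vanish by induction.\<close>
      have "Poly_Mapping.lookup (red_term (m + Poly_Mapping.single j 1)
          (Poly_Mapping.lookup f m)) b' = (if m = b then Poly_Mapping.lookup f b else 0)"
        if "m \<in> Poly_Mapping.keys f" for m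
        using that j less keys
        by (auto simp: red_term_def lookup_single when_def split: option.splits)
      then have "Poly_Mapping.lookup (red (f * mvar j)) b' = Poly_Mapping.lookup f b"
        using b by (simp add: red_mvar lookup_sum sum.delta in_keys_iff)
      with b show False by (simp add: mvar)
    qed
  qed
  then have "f = 0" by (intro poly_mapping_eqI) simp
  then show "a \<in> {\<zero>\<^bsub>quot_alg red_ideal\<^esub>}" by (simp add: a quot_alg_simps)
next
  interpret Q: cring "quot_alg (red_ideal :: ('n, 'k) mpoly set)" by (rule cring_quot_alg)
  fix a assume a: "a \<in> {\<zero>\<^bsub>quot_alg (red_ideal :: ('n, 'k) mpoly set)\<^esub>}"
  \<comment> \<open>Multiplication by zero is known to give zero only on elements of the
    carrier.\<close>
  have "irrelevant_ideal (red_ideal :: ('n, 'k) mpoly set) \<subseteq> carrier (quot_alg red_ideal)"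
    unfolding irrelevant_ideal_def
    by (rule Q.genideal_minimal[OF Q.oneideal]) (auto simp: quot_alg_simps)
  with a have "a \<in> socle red_ideal"
    by (auto simp: socle_def subset_iff)
  moreover have "a \<in> graded_piece red_ideal d"
    using a by (auto simp: graded_piece_red_ideal quot_alg_simps intro!: image_eqI[of _ _ 0])
  ultimately show "a \<in> socle red_ideal \<inter> graded_piece red_ideal d" by blast
qed

end

section \<open>Normal forms for three variables\<close>

text \<open>The elements 0, 1, 2 of the type \<open>3\<close> index x, y, z. On triples, normal
  forms can be evaluated and compared by arithmetic.\<close>

definition triple :: "(3 \<Rightarrow>\<^sub>0 nat) \<Rightarrow> nat \<times> nat \<times> nat" where
  "triple m = (Poly_Mapping.lookup m 0, Poly_Mapping.lookup m 1, Poly_Mapping.lookup m 2)"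

definition expo :: "nat \<times> nat \<times> nat \<Rightarrow> (3 \<Rightarrow>\<^sub>0 nat)" where
  "expo = (\<lambda>(a, b, c).
    Poly_Mapping.single 0 a + Poly_Mapping.single 1 b + Poly_Mapping.single 2 c)"

text \<open>
  Normal forms modulo \<open>Ann(G)\<close>: contracting \<open>G\<close>, a power \<open>x\<^sup>k\<close> with \<open>4 \<le> k \<le> 6\<close> acts like
  \<open>x\<^bsup>k-4\<^esup>y\<^sup>2z\<^sup>2\<close>.
\<close>

fun dual_nf :: "nat \<times> nat \<times> nat \<Rightarrow> (nat \<times> nat \<times> nat) option" where
  "dual_nf (a, b, c) =
    (if a \<le> 2 \<and> b \<le> 2 \<and> c \<le> 2 \<or> a + b + c \<le> 3 then Some (a, b, c)
     else if a \<le> 6 \<and> b = 0 \<and> c = 0 then Some (a - 4, 2, 2)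
     else if a = 0 \<and> b \<le> 6 \<and> c = 0 then Some (2, b - 4, 2)
     else if a = 0 \<and> b = 0 \<and> c \<le> 6 then Some (2, 2, c - 4)
     else None)"

text \<open>Without the factor x^3 only m^10 acts. A multiple of x^3 is divided by it and reduced
  modulo Ann(G); there \<open>dual_nf\<close> kills degrees above 6, which again means total degree
  above 9.\<close>

fun triple_nf :: "nat \<times> nat \<times> nat \<Rightarrow> (nat \<times> nat \<times> nat) option" where
  "triple_nf (a, b, c) =
    (if a < 3 then if a + b + c \<le> 9 then Some (a, b, c) else None
     else map_option (\<lambda>(a, b, c). (a + 3, b, c)) (dual_nf (a - 3, b, c)))"

definition monom_nf :: "(3 \<Rightarrow>\<^sub>0 nat) \<Rightarrow> (3 \<Rightarrow>\<^sub>0 nat) option" where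
  "monom_nf m = map_option expo (triple_nf (triple m))"

fun triple_degree :: "nat \<times> nat \<times> nat \<Rightarrow> nat" where
  "triple_degree (a, b, c) = a + b + c"

fun incr :: "3 \<Rightarrow> nat \<times> nat \<times> nat \<Rightarrow> nat \<times> nat \<times> nat" where
  "incr j (a, b, c) = (if j = 0 then (Suc a, b, c) else if j = 1 then (a, Suc b, c) else (a, b, Suc c))"

lemma exhaust_3: "j = 0 \<or> j = 1 \<or> j = 2" for j :: 3
proof (induct j)
  case (of_int z)
  then have "z = 0 \<or> z = 1 \<or> z = 2" by auto
  then show ?case by auto
qed

lemma UNIV_3: "UNIV = {0, 1, 2 :: 3}"
  using exhaust_3 by auto

lemma triple_expo [simp]: "triple (expo t) = t"
  by (cases t) (simp add: triple_def expo_def lookup_add lookup_single)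

lemma expo_triple [simp]: "expo (triple m) = m"
proof (rule poly_mapping_eqI)
  fix j
  show "Poly_Mapping.lookup (expo (triple m)) j = Poly_Mapping.lookup m j"
    using exhaust_3[of j] by (auto simp: triple_def expo_def lookup_add lookup_single)
qed

lemma expo_eq_iff [simp]: "expo t = expo u \<longleftrightarrow> t = u"
  by (metis triple_expo)

lemma monom_degree_triple: "monom_degree m = triple_degree (triple m)"
  unfolding monom_degree_def UNIV_3 by (simp add: triple_def)

lemma triple_add_single [simp]: "triple (m + Poly_Mapping.single j (Suc 0)) = incr j (triple m)"
  using exhaust_3[of j] by (auto simp: triple_def lookup_add lookup_single)

section \<open>Reduction modulo Ann(G)\<close>

text \<open>Only nine pure powers are rewritten to a different monomial, so claims about
  \<open>dual_nf\<close> come down to a finite check.\<close>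

lemma dual_nf_cases:
  obtains "dual_nf t = None" | "dual_nf t = Some t"
  | k where "k \<in> {4,5,6}" "t \<in> {(k, 0, 0), (0, k, 0), (0, 0, k)}"
proof -
  obtain a b c where t: "t = (a, b, c)" by (cases t)
  show ?thesis
  proof (cases "dual_nf t = None \<or> dual_nf t = Some t")
    case False
    then have "max a (max b c) \<in> {4, 5, 6}"
      "t \<in> {(max a (max b c), 0, 0), (0, max a (max b c), 0), (0, 0, max a (max b c))}"
      by (auto simp: t split: if_splits)
    then show ?thesis using that by blast
  qed (use that in blast)
qed

text \<open>The surviving monomials are the divisors of the four terms of G. The purely arithmetical
  form lets \<open>presburger\<close> prove that multiples of killed monomials are killed.\<close>

lemma dual_nf_eq_None_iff:
  "dual_nf (a, b, c) = None \<longleftrightarrow> \<not> (a \<le> 2 \<and> b \<le> 2 \<and> c \<le> 2) \<and> a + b + c > 3 \<and>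
    \<not> (a \<le> 6 \<and> b = 0 \<and> c = 0) \<and> \<not> (a = 0 \<and> b \<le> 6 \<and> c = 0) \<and> \<not> (a = 0 \<and> b = 0 \<and> c \<le> 6)"
  unfolding dual_nf.simps by (simp add: not_le)

lemma dual_nf_incr_None: "dual_nf t = None \<Longrightarrow> dual_nf (incr j t) = None"
proof -
  assume *: "dual_nf t = None"
  obtain a b c where t: "t = (a, b, c)" by (cases t)
  have "dual_nf (Suc a, b, c) = None"
    using * unfolding t dual_nf_eq_None_iff by presburger
  moreover have "dual_nf (a, Suc b, c) = None"
    using * unfolding t dual_nf_eq_None_iff by presburger
  moreover have "dual_nf (a, b, Suc c) = None"
    using * unfolding t dual_nf_eq_None_iff by presburger
  ultimately show ?thesis
    unfolding t incr.simps by (simp only: split: if_splits) simp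
qed

text \<open>The case to check is a rewritten power: multiplying x^k by y or z kills it, and likewise
  its normal form, while multiplying by x raises both alike or kills both. The powers of y and z are
  symmetric.\<close>

lemma dual_nf_incr: "dual_nf (incr j t) = Option.bind (dual_nf t) (\<lambda>u. dual_nf (incr j u))"
proof (cases t rule: dual_nf_cases)
  case 1
  then show ?thesis by (simp add: dual_nf_incr_None)
next
  case (3 k)
  then show ?thesis using exhaust_3[of j] by auto
qed simp

lemma dual_nf_degree: "dual_nf t = Some u \<Longrightarrow> triple_degree u = triple_degree t"
  by (cases t rule: dual_nf_cases) auto

lemma dual_nf_le: "dual_nf t = Some u \<Longrightarrow> triple_degree t \<le> 6"
  by (cases t) (auto split: if_splits)

lemma dual_nf_idem: "dual_nf t = Some u \<Longrightarrow> dual_nf u = Some u"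
  by (cases t rule: dual_nf_cases) auto

lemma dual_nf_fixed_iff:
  "dual_nf (a, b, c) = Some (a, b, c) \<longleftrightarrow> a \<le> 2 \<and> b \<le> 2 \<and> c \<le> 2 \<or> a + b + c \<le> 3"
  by (auto split: if_splits)

lemma incr_inject [simp]: "incr j s = incr j t \<longleftrightarrow> s = t"
  by (cases s; cases t) auto

text \<open>A rewritten product is a pure power of degree at least 4, while a fixed pure power has
  degree at most 3; so only a cube times its own variable qualifies.\<close>

lemma dual_nf_incr_fixed:
  assumes "dual_nf s = Some s" "dual_nf (incr j s) = Some u" "u \<noteq> incr j s"
  shows "(j, s, u) \<in> {(0, (3, 0, 0), (0, 2, 2)), (1, (0, 3, 0), (2, 0, 2)), (2, (0, 0, 3), (2, 2, 0))}"
proof -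
  obtain a b c where s: "s = (a, b, c)" by (cases s)
  have abc: "a \<le> 2 \<and> b \<le> 2 \<and> c \<le> 2 \<or> a + b + c \<le> 3"
    using assms(1) unfolding s dual_nf_fixed_iff .
  obtain k where "k \<in> {4, 5, 6}" "incr j s \<in> {(k, 0, 0), (0, k, 0), (0, 0, k)}"
    using assms(2,3) by (cases "incr j s" rule: dual_nf_cases) auto
  then show ?thesis
    using abc assms(2) exhaust_3[of j] by (auto simp: s split: if_splits)
qed

text \<open>This is the combinatorial form of the Gorenstein property of R/Ann(G): below degree 6
  there is no socle.\<close>

lemma dual_nf_separated:
  assumes "dual_nf t = Some t" "triple_degree t < 6"
  obtains j u where "dual_nf (incr j t) = Some u"
    "\<And>s. dual_nf s = Some s \<Longrightarrow> dual_nf (incr j s) = Some u \<Longrightarrow> s = t"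
proof -
  obtain a b c where t: "t = (a, b, c)" by (cases t)
  have abc: "a \<le> 2 \<and> b \<le> 2 \<and> c \<le> 2 \<or> a + b + c \<le> 3"
    using assms(1) unfolding t dual_nf_fixed_iff .
  consider "t = (3, 0, 0)" | "t = (0, 3, 0)" | "t = (0, 0, 3)"
    | "a \<le> 2" "b \<le> 2" "c \<le> 2" 
    using abc unfolding t by (cases "a \<le> 2"; cases "b \<le> 2"; cases "c \<le> 2") auto
  then show ?thesis
  proof cases
    case 1
    \<comment> \<open>The normal form of x^4 is not divisible by x, so it is no unreduced product
      with x, and x^3 is its only fixed preimage. The other cubes are symmetric.\<close>
    have "(0, 2, 2) \<noteq> incr 0 s" for s by (cases s) simp
    then show ?thesis
      using 1 by (intro that[of 0 "(0, 2, 2)"]) (auto dest!: dual_nf_incr_fixed simp del: split_paired_All)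
  next
    case 2
    have "(2, 0, 2) \<noteq> incr 1 s" for s by (cases s) simp
    then show ?thesis
      using 2 by (intro that[of 1 "(2, 0, 2)"]) (auto dest!: dual_nf_incr_fixed simp del: split_paired_All)
  next
    case 3
    have "(2, 2, 0) \<noteq> incr 2 s" for s by (cases s) simp
    then show ?thesis
      using 3 by (intro that[of 2 "(2, 2, 0)"]) (auto dest!: dual_nf_incr_fixed simp del: split_paired_All)
  next
    case 4
    \<comment> \<open>In degree below 6 some exponent is below 2; raising it keeps all exponents at
      most 2, so the product is fixed.\<close>
    define j :: 3 where "j = (if a < 2 then 0 else if b < 2 then 1 else 2)"
    have "dual_nf (incr j t) = Some (incr j t)"
      using 4 assms(2) by (auto simp: j_def t)
    moreover have "s = t" if "dual_nf s = Some s" "dual_nf (incr j s) = Some (incr j t)" for s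
    proof (rule ccontr)
      assume "s \<noteq> t"
      \<comment> \<open>A second preimage would be a cube of the variable \<open>j\<close>, whose
        product reduces to a monomial free of that variable, unlike \<open>incr j t\<close>.\<close>
      then have "(j, s, incr j t)
          \<in> {(0, (3, 0, 0), (0, 2, 2)), (1, (0, 3, 0), (2, 0, 2)), (2, (0, 0, 3), (2, 2, 0))}"
        using that by (intro dual_nf_incr_fixed) (auto simp del: incr.simps)
      then show False by (auto simp: t)
    qed
    ultimately show ?thesis by (rule that)
  qed
qed

section \<open>Reduction modulo the whole ideal, with and without the factor x^3\<close>

text \<open>Multiplication by x^3, which carries facts about \<open>dual_nf\<close> over to the
  multiples of x^3.\<close>

definition shift :: "nat \<times> nat \<times> nat \<Rightarrow> nat \<times> nat \<times> nat" where
  "shift = (\<lambda>(a, b, c). (a + 3, b, c))"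

lemma fst_shift [simp]: "fst (shift t) = fst t + 3"
  by (simp add: shift_def case_prod_beta)

lemma triple_degree_shift [simp]: "triple_degree (shift t) = triple_degree t + 3"
  by (cases t) (simp add: shift_def)

lemma incr_shift: "incr j (shift t) = shift (incr j t)"
  by (cases t) (simp add: shift_def)

lemma shift_inject [simp]: "shift s = shift t \<longleftrightarrow> s = t"
  by (cases s; cases t) (simp add: shift_def)

lemma triple_cases:
  obtains "fst t < 3" | s where "t = shift s"
proof (cases "fst t < 3")
  case False
  then have "t = shift (fst t - 3, snd t)"
    by (simp add: shift_def case_prod_beta)
  then show ?thesis by (rule that(2))
qed (rule that(1))

lemma triple_nf_shift: "triple_nf (shift t) = map_option shift (dual_nf t)"
  by (cases t) (simp add: shift_def del: dual_nf.simps)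

lemma triple_nf_less: "fst t < 3 \<Longrightarrow> triple_nf t = (if triple_degree t \<le> 9 then Some t else None)"
  by (cases t) simp

lemma triple_nf_idem: "triple_nf t = Some u \<Longrightarrow> triple_nf u = Some u"
  by (cases t rule: triple_cases)
     (auto simp: triple_nf_shift triple_nf_less dest: dual_nf_idem split: if_splits)

lemma triple_nf_degree: "triple_nf t = Some u \<Longrightarrow> triple_degree u = triple_degree t"
  by (cases t rule: triple_cases)
     (auto simp: triple_nf_shift triple_nf_less dest: dual_nf_degree split: if_splits)

lemma triple_nf_le: "triple_nf t = Some u \<Longrightarrow> triple_degree t \<le> 9"
  by (cases t rule: triple_cases)
     (auto simp: triple_nf_shift triple_nf_less dest: dual_nf_le split: if_splits)

lemma triple_degree_incr [simp]: "triple_degree (incr j t) = Suc (triple_degree t)"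
  by (cases t) simp

text \<open>A monomial without the factor x^3 is its own normal form, or it has degree above 9 and
  so do its multiples, which \<open>triple_nf_le\<close> then excludes. For multiples of x^3 the
  claim is \<open>dual_nf_incr\<close>.\<close>

lemma triple_nf_incr: "triple_nf (incr j t) = Option.bind (triple_nf t) (\<lambda>u. triple_nf (incr j u))"
proof (cases t rule: triple_cases)
  case 1
  then show ?thesis
    using triple_nf_le[of "incr j t"]
    by (cases "triple_nf (incr j t)") (auto simp: triple_nf_less)
next
  case (2 s)
  show ?thesis
    unfolding 2 incr_shift triple_nf_shift dual_nf_incr[of j s]
    by (cases "dual_nf s") (simp_all add: incr_shift triple_nf_shift)
qed

lemma triple_nf_low: "triple_degree t \<le> 1 \<Longrightarrow> triple_nf t = Some t"
  by (cases t) auto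

text \<open>Off x^3 the variable y separates; for multiples of x^3 the variable comes from
  \<open>dual_nf_separated\<close>. Competing monomials of the second kind lack the factor x^3, so
  ranking by the exponent of x treats them first.\<close>

lemma triple_nf_separated:
  assumes "triple_nf t = Some t" "triple_degree t < 9"
  obtains j u where "triple_nf (incr j t) = Some u"
    "\<And>s. triple_nf s = Some s \<Longrightarrow> triple_nf (incr j s) = Some u \<Longrightarrow> s \<noteq> t \<Longrightarrow> fst s < fst t"
proof (cases t rule: triple_cases)
  case 1
  have fst: "fst (incr 1 s) = fst s" for s by (cases s) simp
  show ?thesis
  proof (rule that[of 1 "incr 1 t"])
    show "triple_nf (incr 1 t) = Some (incr 1 t)"
      using 1 assms(2) by (simp add: triple_nf_less fst)
    fix s assume s: "triple_nf (incr 1 s) = Some (incr 1 t)" and "s \<noteq> t"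
    show "fst s < fst t"
    proof (cases s rule: triple_cases)
      case 1
      then show ?thesis using s \<open>s \<noteq> t\<close> by (simp add: triple_nf_less fst split: if_splits)
    next
      case (2 r)
      \<comment> \<open>Reduction preserves the factor x^3, but \<open>incr 1 t\<close> does not
        have it.\<close>
      then obtain v where "shift v = incr 1 t"
        using s by (auto simp: incr_shift triple_nf_shift simp del: split_paired_Ex)
      then have "fst t = fst v + 3" by (metis fst fst_shift)
      with 1 show ?thesis by simp
    qed
  qed
next
  case (2 t')
  \<comment> \<open>Dividing by x^3 turns the bound 9 on the degree into the bound 6.\<close>
  then have "dual_nf t' = Some t'" "triple_degree t' < 6"
    using assms by (auto simp: triple_nf_shift)
  then obtain j u where ju: "dual_nf (incr j t') = Some u"
    "\<And>s. dual_nf s = Some s \<Longrightarrow> dual_nf (incr j s) = Some u \<Longrightarrow> s = t'"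
    by (rule dual_nf_separated) blast
  show ?thesis
  proof (rule that[of j "shift u"])
    show "triple_nf (incr j t) = Some (shift u)"
      using ju(1) by (simp add: 2 incr_shift triple_nf_shift)
    fix s assume s: "triple_nf s = Some s" "triple_nf (incr j s) = Some (shift u)" "s \<noteq> t"
    show "fst s < fst t"
    proof (cases s rule: triple_cases)
      case 1
      then show ?thesis by (simp add: 2)
    next
      case (2 r)
      then have "r = t'" using s by (intro ju(2)) (auto simp: incr_shift triple_nf_shift)
      with s 2 \<open>t = shift t'\<close> show ?thesis by simp
    qed
  qed
qed

section \<open>Finiteness and counting of the fixed monomials\<close>

lemma finite_fixed_monom_nf: "finite {m. monom_nf m = Some m}"
proof -
  have "{m. monom_nf m = Some m} \<subseteq> expo ` ({..9} \<times> {..9} \<times> {..9})"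
  proof
    fix m assume "m \<in> {m. monom_nf m = Some m}"
    then have "triple_degree (triple m) \<le> 9"
      by (auto simp: monom_nf_def dest: triple_nf_le)
    then have "triple m \<in> {..9} \<times> {..9} \<times> {..9}"
      by (cases "triple m") auto
    then show "m \<in> expo ` ({..9} \<times> {..9} \<times> {..9})"
      by (metis expo_triple imageI)
  qed
  then show ?thesis by (rule finite_subset) auto
qed

lemma monomial_reduction_monom_nf: "monomial_reduction monom_nf"
proof
  fix m b j
  show "monom_nf b = Some b" if "monom_nf m = Some b"
    using that by (auto simp: monom_nf_def dest: triple_nf_idem)
  show "monom_degree b = monom_degree m" if "monom_nf m = Some b"
    using that by (auto simp: monom_nf_def monom_degree_triple dest: triple_nf_degree)
  show "monom_nf (m + Poly_Mapping.single j 1) =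
      Option.bind (monom_nf m) (\<lambda>b. monom_nf (b + Poly_Mapping.single j 1))"
    by (cases "triple_nf (triple m)") (simp_all add: monom_nf_def triple_nf_incr[of j "triple m"])
  show "monom_nf m = Some m" if "monom_degree m \<le> 1"
    using triple_nf_low[of "triple m"] that by (simp add: monom_nf_def monom_degree_triple)
qed (rule finite_fixed_monom_nf)

text \<open>The right-hand side lists all triples of degree \<open>d\<close> and can be evaluated;
  \<open>remdups\<close> makes the length of the list the cardinality of its set.\<close>

lemma card_fixed_monom_nf:
  "card {m. monom_nf m = Some m \<and> monom_degree m = d} =
    length (remdups (filter (\<lambda>t. triple_nf t = Some t)
      (concat (map (\<lambda>a. map (\<lambda>b. (a, b, d - a - b)) [0..<Suc d - a]) [0..<Suc d]))))"
proof -
  let ?ts = "concat (map (\<lambda>a. map (\<lambda>b. (a, b, d - a - b)) [0..<Suc d - a]) [0..<Suc d])"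
  have "{m. monom_nf m = Some m \<and> monom_degree m = d} =
      expo ` set (filter (\<lambda>t. triple_nf t = Some t) ?ts)" (is "?L = _")
  proof (intro equalityI subsetI)
    fix m assume m: "m \<in> ?L"
    obtain a b c where abc: "triple m = (a, b, c)" by (cases "triple m")
    have "triple_nf (a, b, c) = Some (a, b, c)" "d = a + b + c"
      using m abc by (auto simp: monom_nf_def monom_degree_triple simp del: triple_nf.simps)
    then have "(a, b, c) \<in> set (filter (\<lambda>t. triple_nf t = Some t) ?ts)"
      by (auto simp del: triple_nf.simps upt_Suc intro!: bexI[of _ a] image_eqI[of _ _ b])
    then show "m \<in> expo ` set (filter (\<lambda>t. triple_nf t = Some t) ?ts)"
      by (rule image_eqI[rotated]) (simp flip: abc)
  qed (auto simp: monom_nf_def monom_degree_triple simp del: triple_nf.simps upt_Suc)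
  moreover have "inj expo" by (simp add: inj_def)
  ultimately show ?thesis
    by (simp only: card_image inj_on_subset[OF _ subset_UNIV] length_remdups_card_conv)
qed

section \<open>The h-vector and the socle of the constructed algebra\<close>

theorem mainTheorem1:
  shows "\<exists>I :: (3, 'k::field_char_0) mpoly set.
    level_algebra I \<and> h_vector I = [1, 3, 6, 10, 15, 21, 28, 27, 27, 28]"
proof -
  interpret monomial_reduction monom_nf by (rule monomial_reduction_monom_nf)
  let ?I = "red_ideal :: (3, 'k) mpoly set"
  \<comment> \<open>The ten values are obtained by evaluating the count of fixed triples.\<close>
  have hilbert: "map (hilbert_function ?I) [0..<10] = [1, 3, 6, 10, 15, 21, 28, 27, 27, 28]"
    unfolding hilbert_function_red_ideal card_fixed_monom_nf
    by code_simp
  have "hilbert_function ?I 9 = 28" using arg_cong[OF hilbert, of "\<lambda>xs. xs ! 9"] by simp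
  moreover have "i \<le> 9" if i: "hilbert_function ?I i > 0" for i
  proof -
    obtain m where "monom_nf m = Some m" "monom_degree m = i"
      using i by (auto simp: hilbert_function_red_ideal card_gt_0_iff)
    then show ?thesis by (auto simp: monom_nf_def monom_degree_triple dest: triple_nf_le)
  qed
  ultimately have socle_degree: "socle_degree ?I = 9"
    unfolding socle_degree_def by (intro Greatest_equality) auto
  have "socle ?I \<inter> graded_piece ?I i = {\<zero>\<^bsub>quot_alg ?I\<^esub>}" if "i < 9" for i
  proof (rule socle_red_ideal)
    fix b assume b: "monom_nf b = Some b" "monom_degree b = i"
    then have "triple_nf (triple b) = Some (triple b)" "triple_degree (triple b) < 9"
      using that by (auto simp: monom_nf_def monom_degree_triple)
    then obtain j u where ju: "triple_nf (incr j (triple b)) = Some u"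
      "\<And>s. triple_nf s = Some s \<Longrightarrow> triple_nf (incr j s) = Some u \<Longrightarrow> s \<noteq> triple b \<Longrightarrow>
        fst s < fst (triple b)"
      by (rule triple_nf_separated) blast
    \<comment> \<open>The rank for \<open>socle_red_ideal\<close> is the exponent of x.\<close>
    have "fst (triple c) < fst (triple b)" if "monom_nf c = Some c"
      "monom_nf (c + Poly_Mapping.single j 1) = Some (expo u)" "c \<noteq> b" for c
    proof (rule ju(2))
      show "triple c \<noteq> triple b" using that(3) by (metis expo_triple)
    qed (use that in \<open>auto simp: monom_nf_def\<close>)
    then show "\<exists>j b'. monom_nf (b + Poly_Mapping.single j 1) = Some b' \<and>
        (\<forall>c. monom_nf c = Some c \<longrightarrow> monom_nf (c + Poly_Mapping.single j 1) = Some b' \<longrightarrow>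
          c \<noteq> b \<longrightarrow> fst (triple c) < fst (triple b))"
      using ju(1) by (intro exI[of _ j] exI[of _ "expo u"]) (simp add: monom_nf_def)
  qed
  then have "level_algebra ?I"
    by (simp add: level_algebra_def socle_degree standard_graded_artinian_red_ideal)
  moreover have "h_vector ?I = [1, 3, 6, 10, 15, 21, 28, 27, 27, 28]"
    using hilbert by (simp add: h_vector_def socle_degree)
  ultimately show ?thesis by blast
qed

end
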